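(* Let $k\ge 2$ and let $G$ be a simple connected $k$-partite graph with $n$ vertices, where $k\leq n-1$, such that the complement $\overline{G}$ is disconnected. Then $$DLS(G)\geq \Big\lfloor \frac{n}{k}\Big\rfloor,$$ with equality if and only if $n\equiv 0 \pmod k$ and $G$ is the complete $k$-partite graph all of whose independent classes have the same cardinality.
   Context: All graphs are finite, simple and connected (complements may be disconnected). For an integer $k\ge 2$, a $k$-partite graph is a graph whose vertex set can be partitioned into $k$ (nonempty) independent classes, so that every edge has its ends in different classes; it is complete $k$-partite if every two vertices from different classes are adjacent. For a connected graph $G$ on vertices $v_1,\dots,v_n$, $d_{uv}$ denotes the distance (length of a shortest path) between $u$ and $v$, and $D(G)=(d_{uv})$ is the distance matrix. The transmission of a vertex $v$ is $Tr(v)=\sum_{u\in V(G)}d_{uv}$. The distance Laplacian matrix is $D^L(G)=\mathrm{diag}(Tr(v_1),\dots,Tr(v_n))-D(G)$; it is positive semidefinite, and its eigenvalues, with multiplicity, are written $\partial_1^L(G)\ge \partial_2^L(G)\ge\dots\ge\partial_n^L(G)=0$. The distance Laplacian spread is $DLS(G)=\partial_1^L(G)-\partial_{n-1}^L(G)$. *)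

theory Defs
  imports
    "Jordan_Normal_Form.Char_Poly"
    "Graph_Theory.Graph_Theory"
    "HOL-Library.Multiset"
    "HOL-Library.Disjoint_Sets"
begin

text \<open>
  A finite simple graph is a \<^locale>\<open>pair_graph\<close>: an undirected edge between \<open>u\<close> and \<open>v\<close>
  is the pair of arcs \<open>(u, v)\<close> and \<open>(v, u)\<close>. All definitions below are meant for such graphs.
\<close>

definition graph_complement :: "'a pair_pre_digraph \<Rightarrow> 'a pair_pre_digraph" where
  "graph_complement G =
    \<lparr> pverts = pverts G,
      parcs = {(u, v). u \<in> pverts G \<and> v \<in> pverts G \<and> u \<noteq> v \<and> (u, v) \<notin> parcs G} \<rparr>"

definition independent_class :: "'a pair_pre_digraph \<Rightarrow> 'a set \<Rightarrow> bool" where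
  "independent_class G A \<longleftrightarrow> A \<subseteq> pverts G \<and> (\<forall>u\<in>A. \<forall>v\<in>A. (u, v) \<notin> parcs G)"

text \<open>The classes of a \<^const>\<open>partition_on\<close> are nonempty.\<close>

definition k_partition :: "nat \<Rightarrow> 'a pair_pre_digraph \<Rightarrow> 'a set set \<Rightarrow> bool" where
  "k_partition k G P \<longleftrightarrow>
    partition_on (pverts G) P \<and> card P = k \<and> (\<forall>A\<in>P. independent_class G A)"

definition k_partite :: "nat \<Rightarrow> 'a pair_pre_digraph \<Rightarrow> bool" where
  "k_partite k G \<longleftrightarrow> (\<exists>P. k_partition k G P)"

definition complete_k_partition :: "nat \<Rightarrow> 'a pair_pre_digraph \<Rightarrow> 'a set set \<Rightarrow> bool" where
  "complete_k_partition k G P \<longleftrightarrow>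
    k_partition k G P \<and>
    (\<forall>A\<in>P. \<forall>B\<in>P. A \<noteq> B \<longrightarrow> (\<forall>u\<in>A. \<forall>v\<in>B. (u, v) \<in> parcs G))"

text \<open>
  The length of a shortest path; a junk value if \<open>u\<close> and \<open>v\<close> are in different components.
\<close>

definition graph_dist :: "'a pair_pre_digraph \<Rightarrow> 'a \<Rightarrow> 'a \<Rightarrow> nat" where
  "graph_dist G u v =
    (LEAST l. \<exists>p. pre_digraph.apath (with_proj G) u p v \<and> length p = l)"

definition transmission :: "'a pair_pre_digraph \<Rightarrow> 'a \<Rightarrow> nat" where
  "transmission G v = (\<Sum>u\<in>pverts G. graph_dist G u v)"

text \<open>
  In the matrices, \<open>vs\<close> is an enumeration \<open>v\<^sub>1, \<dots>, v\<^sub>n\<close> of the vertices without repetition;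
  row and column \<open>i\<close> (counted from 0) belong to \<open>vs ! i\<close>.
\<close>

definition distance_matrix :: "'a pair_pre_digraph \<Rightarrow> 'a list \<Rightarrow> real mat" where
  "distance_matrix G vs =
    mat (length vs) (length vs) (\<lambda>(i, j). real (graph_dist G (vs ! i) (vs ! j)))"

definition distance_laplacian :: "'a pair_pre_digraph \<Rightarrow> 'a list \<Rightarrow> real mat" where
  "distance_laplacian G vs =
    mat_diag (length vs) (\<lambda>i. real (transmission G (vs ! i))) - distance_matrix G vs"

text \<open>
  The real eigenvalues with algebraic multiplicity, in decreasing order. The list has \<open>n\<close> entries
  if the characteristic polynomial of the \<open>n \<times> n\<close> matrix splits over the reals, as it does for
  symmetric matrices.
\<close>

definition real_eigenvalues :: "real mat \<Rightarrow> real list" where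
  "real_eigenvalues M = rev (sorted_list_of_multiset (proots (char_poly M)))"

text \<open>The eigenvalue \<open>\<partial>\<^sub>i\<close>, where \<open>i\<close> is counted from 1.\<close>

definition dl_eigenvalue :: "'a pair_pre_digraph \<Rightarrow> 'a list \<Rightarrow> nat \<Rightarrow> real" where
  "dl_eigenvalue G vs i = real_eigenvalues (distance_laplacian G vs) ! (i - 1)"

definition dl_spread :: "'a pair_pre_digraph \<Rightarrow> 'a list \<Rightarrow> real" where
  "dl_spread G vs = dl_eigenvalue G vs 1 - dl_eigenvalue G vs (length vs - 1)"

end

theory Submission
  imports Defs
begin

text \<open>
  If the complement is disconnected, then two distinct vertices of \<open>G\<close> have distance 1 or 2, according
  to whether they are adjacent. So \<open>D\<^sup>L\<close> is the weighted Laplacian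
  \<open>f \<mapsto> (\<lambda>u. \<Sum>v. c u v * (f u - f v))\<close> with weights \<open>c u v \<in> {1, 2}\<close>, i.e. the Laplacian of the complete
  graph plus that of the complement. Hence 0 is a simple eigenvalue, all others are at least \<open>n\<close>,
  and \<open>n\<close> is attained on a function that is constant on both sides of a cut of the complement;
  so the spread is \<open>\<partial>\<^sub>1 - n\<close>. The Rayleigh quotient of the difference of the indicators of two
  non-adjacent vertices \<open>u\<close>, \<open>v\<close> gives \<open>\<partial>\<^sub>1 - n \<ge> (d u + d v) / 2 + 1\<close>, where \<open>d\<close> is the degree in
  the complement. For two vertices of a class \<open>C\<close> this is at least \<open>card C\<close>, and strictly larger if one
  of them has a non-neighbour outside \<open>C\<close>; averaging over the classes yields the bound and forces
  equal classes and completeness in the case of equality.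
\<close>

subsection \<open>The spectrum of real symmetric matrices\<close>

lemma scalar_prod_self_pos:
  fixes v :: "real vec"
  assumes "v \<in> carrier_vec n" and "v \<noteq> 0\<^sub>v n"
  shows "v \<bullet> v > 0"
proof -
  obtain i where "i < n" "v $ i \<noteq> 0"
    using assms by (metis carrier_vecD eq_vecI index_zero_vec)
  then have "(\<Sum>i<n. v $ i * v $ i) > 0"
    by (intro sum_pos2[of _ i]) (auto simp: zero_less_mult_iff linorder_neq_iff)
  then show ?thesis using assms(1) by (simp add: scalar_prod_def lessThan_atLeast0)
qed

text \<open>For an eigenvector \<open>v\<close>, the form \<open>?q\<close> equals \<open>c\<close>
  times the squared norm of \<open>v\<close>. Conjugation merely exchanges its two indices, because
  \<open>A\<close> is real and symmetric, so \<open>c\<close> equals its own conjugate.\<close>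

lemma complex_eigenvalue_symmetric_real:
  fixes A :: "real mat"
  assumes A: "A \<in> carrier_mat n n" and sym: "A\<^sup>T = A"
    and ev: "eigenvalue (map_mat complex_of_real A) c"
  shows "c \<in> \<real>"
proof -
  let ?A = "map_mat complex_of_real A"
  from ev obtain v where v: "v \<in> carrier_vec n" "v \<noteq> 0\<^sub>v n" "?A *\<^sub>v v = c \<cdot>\<^sub>v v"
    using A unfolding eigenvalue_def eigenvector_def by auto
  have dv: "dim_vec v = n" using v(1) by simp
  have Asym: "A $$ (i, j) = A $$ (j, i)" if "i < n" "j < n" for i j
    using sym A that by (metis carrier_matD index_transpose_mat(1))
  have Av: "(\<Sum>j<n. of_real (A $$ (i, j)) * v $ j) = c * v $ i" if "i < n" for i
  proof -
    have "(?A *\<^sub>v v) $ i = (c \<cdot>\<^sub>v v) $ i" using v(3) by simp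
    then show ?thesis using that A v(1)
      by (simp add: scalar_prod_def lessThan_atLeast0 mult.commute)
  qed
  let ?q = "\<Sum>i<n. \<Sum>j<n. of_real (A $$ (i, j)) * (cnj (v $ i) * v $ j)"
  let ?N = "\<Sum>i<n. (cmod (v $ i))\<^sup>2"
  have "?q = (\<Sum>i<n. cnj (v $ i) * (c * v $ i))"
    by (intro sum.cong refl, subst Av[symmetric]) (auto simp: sum_distrib_left mult_ac)
  also have "\<dots> = c * of_real ?N"
    by (simp add: sum_distrib_left mult_ac complex_norm_square del: of_real_power)
  finally have q: "?q = c * of_real ?N" .
  have "cnj ?q = (\<Sum>i<n. \<Sum>j<n. of_real (A $$ (j, i)) * (cnj (v $ j) * v $ i))"
    by (auto simp: mult_ac Asym intro!: sum.cong)
  also have "\<dots> = ?q" by (rule sum.swap)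
  finally have "cnj ?q = ?q" .
  then have "cnj c * of_real ?N = c * of_real ?N" unfolding q by simp
  moreover have "?N \<noteq> 0"
  proof
    assume "?N = 0"
    then have "\<forall>i<n. v $ i = 0" by (subst (asm) sum_nonneg_eq_0_iff) auto
    then have "v = 0\<^sub>v n" using dv by (intro eq_vecI) auto
    with v(2) show False ..
  qed
  ultimately have "cnj c = c" by (metis mult_right_cancel of_real_eq_0_iff)
  then show ?thesis by (simp add: Reals_cnj_iff)
qed

text \<open>Over the complex numbers the characteristic polynomial splits, so it has a root as soon
  as \<open>n > 0\<close>. That root is real, hence a root of the real polynomial as well.\<close>

lemma symmetric_has_real_eigenvalue:
  fixes A :: "real mat"
  assumes A: "A \<in> carrier_mat n n" and sym: "A\<^sup>T = A" and n: "n > 0"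
  obtains e where "eigenvalue A e"
proof -
  let ?A = "map_mat complex_of_real A"
  have cA: "?A \<in> carrier_mat n n" using A by simp
  obtain as where as: "char_poly ?A = (\<Prod>a\<leftarrow>as. [:- a, 1:])" "length as = n"
    using char_poly_factorized[OF cA] by blast
  obtain c where c: "c \<in> set as" using as(2) n by (cases as) auto
  then have "poly (char_poly ?A) c = 0"
    unfolding as(1) by (auto simp: poly_prod_list prod_list_zero_iff)
  moreover from this obtain e where e: "c = of_real e"
    using complex_eigenvalue_symmetric_real[OF A sym] eigenvalue_root_char_poly[OF cA]
    by (auto elim: Reals_cases)
  ultimately have "poly (char_poly A) e = 0"
    unfolding of_real_hom.char_poly_hom[OF A] by simp
  then show ?thesis using that eigenvalue_root_char_poly[OF A] by auto
qed

text \<open>The Householder reflection that exchanges \<open>v\<close> and the first unit vector; if they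
  are equal, then \<open>c = 2 / 0 = 0\<close> and the matrix is the identity.\<close>

lemma reflection_to_first_unit_vector:
  fixes v :: "real vec"
  assumes v: "v \<in> carrier_vec n" and n: "n > 0" and norm: "v \<bullet> v = 1"
  obtains H where "H \<in> carrier_mat n n" "H\<^sup>T = H" "H * H = 1\<^sub>m n" "H *\<^sub>v unit_vec n 0 = v"
proof -
  define w where "w i = v $ i - (if i = 0 then 1 else 0)" for i
  define s where "s = (\<Sum>i<n. w i * w i)"
  define c where "c = 2 / s"
  define H where "H = mat n n (\<lambda>(i, j). (if i = j then 1 else 0) - c * w i * w j)"
  have dv: "dim_vec v = n" using v by simp
  have norm': "(\<Sum>i<n. v $ i * v $ i) = 1"
    using norm dv by (simp add: scalar_prod_def lessThan_atLeast0)
  \<comment> \<open>The vector \<open>w\<close> is \<open>v\<close> minus the first unit vector. As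
    \<open>v\<close> has norm 1, its squared norm is \<open>2 - 2 * v $ 0\<close>, so
    \<open>c * w 0 = - 1\<close> unless \<open>s = 0\<close>.\<close>
  have "s = (\<Sum>i<n. v $ i * v $ i) - 2 * (\<Sum>i<n. if i = 0 then v $ i else 0)
      + (\<Sum>i<n. if i = 0 then 1 else 0)"
    unfolding s_def w_def sum_distrib_left sum_subtractf[symmetric] sum.distrib[symmetric]
    by (intro sum.cong) (auto simp: algebra_simps)
  then have s: "s = - 2 * w 0"
    using n norm' by (simp add: w_def)
  have w0: "w i = 0" if "s = 0" "i < n" for i
    using that unfolding s_def by (subst (asm) sum_nonneg_eq_0_iff) auto
  \<comment> \<open>This also holds for \<open>s = 0\<close>, where \<open>c\<close> is 0. In
    \<open>H * H\<close> it makes the quadratic term cancel the two linear ones.\<close>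
  have cs: "c * c * s = 2 * c" by (auto simp: c_def)
  have cw: "c * w 0 * w i = - w i" if "i < n" for i
    using w0[OF _ that] by (cases "s = 0") (auto simp: c_def s)
  have H: "H \<in> carrier_mat n n" by (simp add: H_def)
  have "H\<^sup>T = H" by (rule eq_matI) (auto simp: H_def)
  moreover have "H * H = 1\<^sub>m n"
  proof (rule eq_matI)
    fix i j assume "i < dim_row (1\<^sub>m n :: real mat)" "j < dim_col (1\<^sub>m n :: real mat)"
    then have ij: "i < n" "j < n" by auto
    have "(H * H) $$ (i, j) = (\<Sum>k<n. ((if i = k then 1 else 0) - c * w i * w k)
        * ((if k = j then 1 else 0) - c * w k * w j))"
      using ij by (simp add: H_def scalar_prod_def lessThan_atLeast0)
    also have "\<dots> = (\<Sum>k<n. if i = k then (if k = j then 1 else 0) else 0)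
        - (\<Sum>k<n. if k = i then c * w k * w j else 0) - (\<Sum>k<n. if k = j then c * w i * w k else 0)
        + (\<Sum>k<n. c * c * w i * w j * (w k * w k))"
      unfolding sum_subtractf[symmetric] sum.distrib[symmetric]
      by (intro sum.cong) (auto simp: algebra_simps)
    also have "\<dots> = (if i = j then 1 else 0) - 2 * c * w i * w j + (c * c * s) * w i * w j"
      using ij by (simp add: s_def sum_distrib_left sum_distrib_right mult_ac)
    also have "\<dots> = (if i = j then 1 else 0)" unfolding cs by simp
    finally show "(H * H) $$ (i, j) = 1\<^sub>m n $$ (i, j)" using ij by simp
  qed (use H in auto)
  moreover have "H *\<^sub>v unit_vec n 0 = v"
  proof (rule eq_vecI)
    fix i assume "i < dim_vec v"
    then have i: "i < n" using dv by simp
    have "(H *\<^sub>v unit_vec n 0) $ i = H $$ (i, 0)"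
      using i n H by simp
    also have "\<dots> = v $ i" using cw[OF i] i n by (auto simp: H_def w_def mult_ac)
    finally show "(H *\<^sub>v unit_vec n 0) $ i = v $ i" .
  qed (use H dv in auto)
  ultimately show ?thesis using that H by blast
qed

text \<open>Induction on the dimension by deflation: conjugating \<open>A\<close> with a reflection
  that sends the first unit vector to a normalised eigenvector splits off a block of size 1. The
  remaining block \<open>C\<close> is symmetric and is diagonalised by some \<open>V\<close>; then
  \<open>H * W\<close> works for \<open>A\<close>, where \<open>W\<close> extends \<open>V\<close>
  by a 1 in the corner.\<close>

theorem symmetric_orthogonally_diagonalizable:
  fixes A :: "real mat"
  assumes "A \<in> carrier_mat n n" and "A\<^sup>T = A"
  shows "\<exists>U D. U \<in> carrier_mat n n \<and> D \<in> carrier_mat n n \<and> U\<^sup>T * U = 1\<^sub>m n \<and> diagonal_mat D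
    \<and> A = U * D * U\<^sup>T"
  using assms
proof (induction n arbitrary: A)
  case 0
  then show ?case
    by (intro exI[of _ "1\<^sub>m 0"]) (auto simp: diagonal_mat_def intro!: eq_matI)
next
  case (Suc m)
  let ?n = "Suc m"
  note A = Suc.prems(1) and sym = Suc.prems(2)
  obtain e where "eigenvalue A e"
    using symmetric_has_real_eigenvalue[OF A sym] by auto
  then obtain u where u: "u \<in> carrier_vec ?n" "u \<noteq> 0\<^sub>v ?n" "A *\<^sub>v u = e \<cdot>\<^sub>v u"
    using A unfolding eigenvalue_def eigenvector_def by auto
  define r where "r = sqrt (u \<bullet> u)"
  have "u \<bullet> u > 0" using u(1,2) by (rule scalar_prod_self_pos)
  then have r: "r > 0" "r * r = u \<bullet> u" by (auto simp: r_def)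
  define v where "v = (1 / r) \<cdot>\<^sub>v u"
  have v: "v \<in> carrier_vec ?n" using u(1) by (simp add: v_def)
  have vv: "v \<bullet> v = 1" using u(1) r \<open>u \<bullet> u > 0\<close> by (simp add: v_def)
  have Av: "A *\<^sub>v v = e \<cdot>\<^sub>v v"
    using u A by (simp add: v_def mult_mat_vec smult_smult_assoc mult.commute)
  obtain H where H: "H \<in> carrier_mat ?n ?n" "H\<^sup>T = H" "H * H = 1\<^sub>m ?n"
    and Hv: "H *\<^sub>v unit_vec ?n 0 = v"
    using reflection_to_first_unit_vector[OF v _ vv] by auto
  define B where "B = H * A * H"
  have B: "B \<in> carrier_mat ?n ?n" using H A by (auto simp: B_def)
  have symB: "B\<^sup>T = B"
    using H A sym by (simp add: B_def transpose_mult[of _ ?n ?n _ ?n] assoc_mult_mat[of _ ?n ?n _ ?n _ ?n])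
  \<comment> \<open>The reflection is an involution, so it also maps \<open>v\<close> back to the
    unit vector.\<close>
  have Hv': "H *\<^sub>v v = unit_vec ?n 0"
    using H by (simp flip: Hv add: assoc_mult_mat_vec[symmetric, of _ ?n ?n _ ?n])
  have "B *\<^sub>v unit_vec ?n 0 = e \<cdot>\<^sub>v unit_vec ?n 0"
  proof -
    have "B *\<^sub>v unit_vec ?n 0 = H *\<^sub>v (A *\<^sub>v (H *\<^sub>v unit_vec ?n 0))"
      using H A unfolding B_def by (simp add: assoc_mult_mat_vec[of _ ?n ?n _ ?n])
    then show ?thesis unfolding Hv Av using H v by (simp add: mult_mat_vec Hv')
  qed
  then have Be: "(B *\<^sub>v unit_vec ?n 0) $ i = (e \<cdot>\<^sub>v unit_vec ?n 0) $ i" for i by simp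
  have col0: "B $$ (i, 0) = (if i = 0 then e else 0)" if "i < ?n" for i
  proof -
    have "B $$ (i, 0) = (B *\<^sub>v unit_vec ?n 0) $ i" using that B by simp
    also have "\<dots> = (if i = 0 then e else 0)" unfolding Be using that by simp
    finally show ?thesis .
  qed
  have Bsym: "B $$ (i, j) = B $$ (j, i)" if "i < ?n" "j < ?n" for i j
    using symB B that by (metis carrier_matD index_transpose_mat(1))
  define C where "C = mat m m (\<lambda>(i, j). B $$ (Suc i, Suc j))"
  have C: "C \<in> carrier_mat m m" by (simp add: C_def)
  have "C\<^sup>T = C" by (rule eq_matI) (auto simp: C_def intro: Bsym)
  from Suc.IH[OF C this] obtain V E where V: "V \<in> carrier_mat m m" and E: "E \<in> carrier_mat m m"
    and VV: "V\<^sup>T * V = 1\<^sub>m m" and dE: "diagonal_mat E" and CV: "C = V * E * V\<^sup>T" by blast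
  let ?e = "e \<cdot>\<^sub>m 1\<^sub>m 1 :: real mat"
  let ?fb = "\<lambda>X Y :: real mat. four_block_mat X (0\<^sub>m 1 m) (0\<^sub>m m 1) Y"
  have fb: "?fb X Y * ?fb X' Y' = ?fb (X * X') (Y * Y')"
    if "X \<in> carrier_mat 1 1" "X' \<in> carrier_mat 1 1" "Y \<in> carrier_mat m m" "Y' \<in> carrier_mat m m"
    for X X' Y Y'
    using that by (subst mult_four_block_mat[of _ 1 1 _ m _ m _ _ 1 _ m]) auto
  have fbT: "(?fb X Y)\<^sup>T = ?fb X\<^sup>T Y\<^sup>T"
    if "X \<in> carrier_mat 1 1" "Y \<in> carrier_mat m m" for X Y
    using that by (subst transpose_four_block_mat[of _ 1 1 _ m _ m]) auto
  \<comment> \<open>The first column of \<open>B\<close> is \<open>e\<close> times the unit vector;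
    by symmetry the same is true of the first row.\<close>
  have Bfb: "B = ?fb ?e C"
  proof (rule eq_matI)
    fix i j assume "i < dim_row (?fb ?e C)" "j < dim_col (?fb ?e C)"
    then have ij: "i < ?n" "j < ?n" using C by auto
    then show "B $$ (i, j) = ?fb ?e C $$ (i, j)"
      using col0[of i] col0[of j] Bsym[of i j] C by (cases i; cases j) (auto simp: C_def)
  qed (use B C in auto)
  define W where "W = ?fb (1\<^sub>m 1) V"
  define D where "D = ?fb ?e E"
  have W: "W \<in> carrier_mat ?n ?n" and D: "D \<in> carrier_mat ?n ?n"
    using V E four_block_carrier_mat[of _ 1 1 _ m m] by (auto simp: W_def D_def)
  have one: "1\<^sub>m ?n = ?fb (1\<^sub>m 1) (1\<^sub>m m)"
    by (rule eq_matI) auto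
  have WT: "W\<^sup>T = ?fb (1\<^sub>m 1) V\<^sup>T"
    unfolding W_def using V by (subst fbT) auto
  have "W\<^sup>T * W = ?fb (1\<^sub>m 1 * 1\<^sub>m 1) (V\<^sup>T * V)"
    unfolding WT unfolding W_def by (rule fb) (use V in auto)
  also have "1\<^sub>m 1 * 1\<^sub>m 1 = (1\<^sub>m 1 :: real mat)" by (rule left_mult_one_mat[where nc = 1]) simp
  finally have WW: "W\<^sup>T * W = 1\<^sub>m ?n" by (simp only: VV one)
  have "W * D = ?fb (1\<^sub>m 1 * ?e) (V * E)"
    unfolding W_def D_def by (rule fb) (use V E in auto)
  also have "1\<^sub>m 1 * ?e = ?e" by (rule left_mult_one_mat[where nc = 1]) simp
  finally have WD: "W * D = ?fb ?e (V * E)" .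
  have "W * D * W\<^sup>T = ?fb (?e * 1\<^sub>m 1) (V * E * V\<^sup>T)"
    unfolding WD WT by (rule fb) (use V E in auto)
  also have "?e * 1\<^sub>m 1 = ?e" by (rule right_mult_one_mat[where nr = 1]) simp
  finally have BW: "B = W * D * W\<^sup>T" by (simp only: Bfb CV)
  have "diagonal_mat D"
    using dE E unfolding diagonal_mat_def D_def by (auto split: nat_diff_split)
  moreover have "H * W \<in> carrier_mat ?n ?n" using H W by simp
  moreover have "(H * W)\<^sup>T * (H * W) = 1\<^sub>m ?n"
  proof -
    have "(H * W)\<^sup>T * (H * W) = W\<^sup>T * (H * H) * W"
      using H(1,2) W by (simp add: transpose_mult[of _ ?n ?n _ ?n] assoc_mult_mat[of _ ?n ?n _ ?n _ ?n])
    then show ?thesis using H(3) W WW by simp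
  qed
  moreover have "A = (H * W) * D * (H * W)\<^sup>T"
  proof -
    have "(H * W) * D * (H * W)\<^sup>T = H * B * H"
      using H(1,2) W D by (simp add: BW transpose_mult[of _ ?n ?n _ ?n] assoc_mult_mat[of _ ?n ?n _ ?n _ ?n])
    also have "\<dots> = (H * H) * A * (H * H)"
      using H(1) A by (simp add: B_def assoc_mult_mat[of _ ?n ?n _ ?n _ ?n])
    finally show ?thesis using H(3) A by simp
  qed
  ultimately show ?case using D by blast
qed

text \<open>The columns of the orthogonal matrix \<open>U\<close> are the eigenvectors, and
  similarity to the diagonal matrix \<open>D\<close> gives the eigenvalues with multiplicity. The
  last two conclusions, Parseval's identity and its analogue for the quadratic form, serve to bound
  Rayleigh quotients.\<close>

theorem symmetric_eigenbasis:
  fixes A :: "real mat"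
  assumes A: "A \<in> carrier_mat n n" and sym: "A\<^sup>T = A"
  obtains u d where "\<And>i. i < n \<Longrightarrow> u i \<in> carrier_vec n"
    and "\<And>i j. i < n \<Longrightarrow> j < n \<Longrightarrow> u i \<bullet> u j = (if i = j then 1 else 0)"
    and "\<And>i. i < n \<Longrightarrow> A *\<^sub>v u i = d i \<cdot>\<^sub>v u i"
    and "proots (char_poly A) = mset (map d [0..<n])"
    and "\<And>x. x \<in> carrier_vec n \<Longrightarrow> x \<bullet> x = (\<Sum>i<n. (u i \<bullet> x)\<^sup>2)"
    and "\<And>x. x \<in> carrier_vec n \<Longrightarrow> x \<bullet> (A *\<^sub>v x) = (\<Sum>i<n. d i * (u i \<bullet> x)\<^sup>2)"
proof -
  obtain U D where U: "U \<in> carrier_mat n n" and D: "D \<in> carrier_mat n n"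
    and UU: "U\<^sup>T * U = 1\<^sub>m n" and dD: "diagonal_mat D" and AUD: "A = U * D * U\<^sup>T"
    using symmetric_orthogonally_diagonalizable[OF A sym] by blast
  define d where "d i = D $$ (i, i)" for i
  define u where "u i = col U i" for i
  have UU': "U * U\<^sup>T = 1\<^sub>m n"
    using U UU by (intro mat_mult_left_right_inverse[of "U\<^sup>T" n U]) auto
  have Dij: "D $$ (i, j) = (if i = j then d i else 0)" if "i < n" "j < n" for i j
    using dD D that by (auto simp: diagonal_mat_def d_def)
  have uc: "u i \<in> carrier_vec n" if "i < n" for i
    using col_dim[of U i] U by (simp add: u_def)
  have orth: "u i \<bullet> u j = (if i = j then 1 else 0)" if "i < n" "j < n" for i j
  proof -
    have "u i \<bullet> u j = (U\<^sup>T * U) $$ (i, j)" using U that by (simp add: u_def)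
    then show ?thesis using that by (simp add: UU)
  qed
  have ev: "A *\<^sub>v u i = d i \<cdot>\<^sub>v u i" if i: "i < n" for i
  proof -
    have "A * U = U * D"
      using U D UU by (simp add: AUD assoc_mult_mat[of _ n n _ n _ n])
    then have "A *\<^sub>v u i = U *\<^sub>v col D i"
      using A U D i by (metis carrier_matD(2) col_mult2 u_def)
    also have "col D i = d i \<cdot>\<^sub>v unit_vec n i"
      using D i by (intro eq_vecI) (auto simp: Dij)
    also have "U *\<^sub>v \<dots> = d i \<cdot>\<^sub>v u i"
      using U i by (auto simp: mult_mat_vec[of _ n n] u_def intro!: eq_vecI)
    finally show ?thesis .
  qed
  have roots: "proots (char_poly A) = mset (map d [0..<n])"
  proof -
    have "similar_mat A D"
      by (rule similar_matI[of _ _ U "U\<^sup>T" n]) (use A D U UU UU' AUD in auto)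
    then have "char_poly A = char_poly D" by (rule char_poly_similar)
    also have "\<dots> = (\<Prod>a\<leftarrow>diag_mat D. [:- a, 1:])"
      using dD D by (intro char_poly_upper_triangular[OF D])
        (auto simp: diagonal_mat_def upper_triangular_def)
    also have "diag_mat D = map d [0..<n]" using D by (simp add: diag_mat_def d_def)
    finally have "char_poly A = (\<Prod>a\<leftarrow>map d [0..<n]. [:- a, 1:])" .
    moreover have "proots (\<Prod>a\<leftarrow>as. [:- a, 1:]) = mset as" for as :: "real list"
    proof (induction as)
      case (Cons a as)
      have "(\<Prod>a\<leftarrow>as. [:- a, 1:]) \<noteq> 0" by (auto simp: prod_list_zero_iff)
      then show ?case using Cons by (simp add: proots_mult del: mult_pCons_left)
    qed simp
    ultimately show ?thesis by (simp only:)
  qed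
  have Ux: "(U\<^sup>T *\<^sub>v x) $ i = u i \<bullet> x" if "i < n" for x i using U that by (simp add: u_def)
  have xx: "x \<bullet> x = (\<Sum>i<n. (u i \<bullet> x)\<^sup>2)" if x: "x \<in> carrier_vec n" for x
  proof -
    have "x \<bullet> x = x \<bullet> (U *\<^sub>v (U\<^sup>T *\<^sub>v x))"
      using U x UU' by (simp flip: assoc_mult_mat_vec[of _ n n _ n])
    also have "\<dots> = (U\<^sup>T *\<^sub>v x) \<bullet> (U\<^sup>T *\<^sub>v x)"
      using U x by (intro transpose_vec_mult_scalar[symmetric, of _ n n]) auto
    also have "\<dots> = (\<Sum>i<n. (u i \<bullet> x)\<^sup>2)"
      using U unfolding scalar_prod_def[of "U\<^sup>T *\<^sub>v x"]
      by (auto simp: lessThan_atLeast0 power2_eq_square u_def intro!: sum.cong)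
    finally show ?thesis .
  qed
  have xAx: "x \<bullet> (A *\<^sub>v x) = (\<Sum>i<n. d i * (u i \<bullet> x)\<^sup>2)" if x: "x \<in> carrier_vec n" for x
  proof -
    have "x \<bullet> (A *\<^sub>v x) = x \<bullet> (U *\<^sub>v (D *\<^sub>v (U\<^sup>T *\<^sub>v x)))"
      using U D x by (simp add: AUD assoc_mult_mat_vec[of _ n n _ n])
    also have "\<dots> = (U\<^sup>T *\<^sub>v x) \<bullet> (D *\<^sub>v (U\<^sup>T *\<^sub>v x))"
      using U D x by (intro transpose_vec_mult_scalar[symmetric, of _ n n]) auto
    also have "\<dots> = (\<Sum>i<n. (u i \<bullet> x) * (D *\<^sub>v (U\<^sup>T *\<^sub>v x)) $ i)"
      using U D unfolding scalar_prod_def[of "U\<^sup>T *\<^sub>v x"]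
      by (auto simp: lessThan_atLeast0 u_def intro!: sum.cong)
    also have "\<dots> = (\<Sum>i<n. d i * (u i \<bullet> x)\<^sup>2)"
    proof (rule sum.cong)
      fix i assume "i \<in> {..<n}"
      then have i: "i < n" by simp
      have "(D *\<^sub>v (U\<^sup>T *\<^sub>v x)) $ i = (\<Sum>j<n. D $$ (i, j) * (u j \<bullet> x))"
        using i U D by (auto simp: scalar_prod_def[of "row D i"] lessThan_atLeast0 u_def intro!: sum.cong)
      also have "\<dots> = (\<Sum>j<n. if j = i then d i * (u i \<bullet> x) else 0)"
        using i by (intro sum.cong) (auto simp: Dij)
      also have "\<dots> = d i * (u i \<bullet> x)" using i by simp
      finally show "(u i \<bullet> x) * (D *\<^sub>v (U\<^sup>T *\<^sub>v x)) $ i = d i * (u i \<bullet> x)\<^sup>2"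
        by (simp add: power2_eq_square)
    qed simp
    finally show ?thesis .
  qed
  show ?thesis by (rule that[OF uc orth ev roots xx xAx])
qed

section \<open>Eigenvalue lists, Rayleigh quotients and multiplicities\<close>

lemma set_real_eigenvalues:
  assumes "A \<in> carrier_mat n n"
  shows "set (real_eigenvalues A) = {e. eigenvalue A e}"
proof -
  have "char_poly A \<noteq> 0" using degree_monic_char_poly[OF assms] by force
  then show ?thesis
    by (simp add: real_eigenvalues_def eigenvalue_root_char_poly[OF assms])
qed

text \<open>By symmetry all roots of the characteristic polynomial are real, so the list misses none
  of them and counting from its end is meaningful.\<close>

lemma length_real_eigenvalues:
  assumes "A \<in> carrier_mat n n" and "A\<^sup>T = A"
  shows "length (real_eigenvalues A) = n"
proof -
  obtain d where "proots (char_poly A) = mset (map d [0..<n])"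
    by (rule symmetric_eigenbasis[OF assms])
  then have "size (proots (char_poly A)) = n" by simp
  then show ?thesis
    unfolding real_eigenvalues_def by (metis length_rev mset_sorted_list_of_multiset size_mset)
qed

text \<open>In the eigenbasis the form is a sum of squares weighted by the eigenvalues, each of
  which is at most the head of the decreasing list.\<close>

lemma rayleigh_le_largest_real_eigenvalue:
  assumes A: "A \<in> carrier_mat n n" and sym: "A\<^sup>T = A" and x: "x \<in> carrier_vec n"
  shows "x \<bullet> (A *\<^sub>v x) \<le> real_eigenvalues A ! 0 * (x \<bullet> x)"
proof -
  obtain u d where roots: "proots (char_poly A) = mset (map d [0..<n])"
    and *: "\<And>x. x \<in> carrier_vec n \<Longrightarrow> x \<bullet> x = (\<Sum>i<n. (u i \<bullet> x)\<^sup>2)"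
      "\<And>x. x \<in> carrier_vec n \<Longrightarrow> x \<bullet> (A *\<^sub>v x) = (\<Sum>i<n. d i * (u i \<bullet> x)\<^sup>2)"
    by (rule symmetric_eigenbasis[OF A sym], rule that)
  note xx = *(1)[OF x] and xAx = *(2)[OF x]
  let ?L = "real_eigenvalues A"
  have "d i \<le> ?L ! 0" if "i < n" for i
  proof -
    have "d i \<in> set ?L" using that by (simp add: real_eigenvalues_def roots)
    moreover have "sorted_wrt (\<ge>) ?L" by (simp add: real_eigenvalues_def sorted_wrt_rev)
    ultimately show ?thesis by (cases ?L) auto
  qed
  then show ?thesis
    unfolding xx xAx sum_distrib_left by (intro sum_mono mult_right_mono) auto
qed

text \<open>If \<open>e\<close> occurred at two indices of the orthonormal eigenbasis, there would
  be two orthogonal eigenvectors for \<open>e\<close>. The hypothesis \<open>simple\<close> is a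
  convenient form of having a one-dimensional eigenspace.\<close>

lemma real_eigenvalue_simple:
  fixes A :: "real mat"
  assumes A: "A \<in> carrier_mat n n" and sym: "A\<^sup>T = A" and e: "eigenvalue A e"
    and simple: "\<And>v w. eigenvector A v e \<Longrightarrow> eigenvector A w e \<Longrightarrow> v \<bullet> w \<noteq> 0"
  shows "count (proots (char_poly A)) e = 1"
proof -
  obtain u d where u: "\<And>i. i < n \<Longrightarrow> u i \<in> carrier_vec n"
    and orth: "\<And>i j. i < n \<Longrightarrow> j < n \<Longrightarrow> u i \<bullet> u j = (if i = j then 1 else 0)"
    and ev: "\<And>i. i < n \<Longrightarrow> A *\<^sub>v u i = d i \<cdot>\<^sub>v u i"
    and roots: "proots (char_poly A) = mset (map d [0..<n])"
    by (rule symmetric_eigenbasis[OF A sym], rule that)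
  have "e \<in># proots (char_poly A)"
    using e set_real_eigenvalues[OF A] by (simp add: real_eigenvalues_def)
  then obtain i where i: "i < n" "d i = e" unfolding roots by auto
  have vec: "eigenvector A (u j) e" if "j < n" "d j = e" for j
    using that u[of j] ev[of j] orth[of j j] A by (auto simp: eigenvector_def)
  have "j = i" if "j < n" "d j = e" for j
    using simple[OF vec[OF that] vec[OF i]] orth[OF that(1) i(1)] by (auto split: if_splits)
  then have "{j. j < n \<and> d j = e} = {i}" using i by blast
  moreover have "{j. j < length (map d [0..<n]) \<and> e = map d [0..<n] ! j} = {j. j < n \<and> d j = e}"
    by auto
  ultimately have "count (mset (map d [0..<n])) e = 1"
    unfolding count_mset count_list_eq_length_filter length_filter_conv_card
    by (simp only: card.empty card_insert_disjoint) simp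
  then show ?thesis by (simp only: roots)
qed

text \<open>The ascending list starts with \<open>a\<close> and \<open>c\<close>. In the reversed
  list, counted from 0, \<open>c\<close> therefore stands at position
  \<open>size M - 2\<close>.\<close>

lemma second_smallest_of_sorted:
  fixes M :: "'b::linorder multiset"
  assumes "count M a = 1" and "c \<in># M" and "a < c" and "\<And>x. x \<in># M \<Longrightarrow> x = a \<or> c \<le> x"
  shows "rev (sorted_list_of_multiset M) ! (size M - 2) = c"
proof -
  obtain M' where M: "M = add_mset c M'" using assms(2) by (metis insert_DiffM)
  then have "count M' a = 1" using assms(1,3) by (auto split: if_splits)
  then obtain N where N: "M' = add_mset a N"
    by (metis count_eq_zero_iff insert_DiffM zero_neq_one)
  have aN: "a \<notin># N" using \<open>count M' a = 1\<close> N by (simp add: count_eq_zero_iff)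
  let ?L = "a # c # sorted_list_of_multiset N"
  have "sorted ?L"
    using assms(3,4) aN by (fastforce simp: M N)
  then have "sorted_list_of_multiset (mset ?L) = ?L"
    by (simp only: sorted_list_of_multiset_mset sorted_sort_id)
  moreover have "mset ?L = M" by (simp add: M N)
  ultimately have "sorted_list_of_multiset M = ?L" by (simp only:)
  moreover have "length (sorted_list_of_multiset N) = size M - 2"
    using size_mset[of "sorted_list_of_multiset N"] by (simp add: M N)
  ultimately show ?thesis by (simp add: nth_append)
qed

subsection \<open>Weighted Laplacians\<close>

definition weighted_laplacian :: "'a set \<Rightarrow> ('a \<Rightarrow> 'a \<Rightarrow> real) \<Rightarrow> ('a \<Rightarrow> real) \<Rightarrow> 'a \<Rightarrow> real" where
  "weighted_laplacian V c f u = (\<Sum>v\<in>V. c u v * (f u - f v))"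

text \<open>The diagonal terms are multiples of \<open>f u - f u\<close>, so only the weights of
  distinct vertices matter. This permits passing from distances, which are 0 on the diagonal, to
  weights that are at least 1 everywhere.\<close>

lemma weighted_laplacian_cong:
  assumes "\<And>u v. u \<in> V \<Longrightarrow> v \<in> V \<Longrightarrow> u \<noteq> v \<Longrightarrow> c u v = c' u v" and "u \<in> V"
  shows "weighted_laplacian V c f u = weighted_laplacian V c' f u"
  unfolding weighted_laplacian_def
proof (rule sum.cong)
  fix v assume "v \<in> V"
  then show "c u v * (f u - f v) = c' u v * (f u - f v)" using assms by (cases "u = v") auto
qed simp

text \<open>Weights of at least 1 make the quadratic form dominate that of the complete graph, whose
  nonzero Laplacian eigenvalues all equal \<open>card V\<close>.\<close>

locale symmetric_weights =
  fixes V :: "'a set" and c :: "'a \<Rightarrow> 'a \<Rightarrow> real"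
  assumes fin: "finite V"
    and sym: "\<And>u v. u \<in> V \<Longrightarrow> v \<in> V \<Longrightarrow> c u v = c v u"
    and ge1: "\<And>u v. u \<in> V \<Longrightarrow> v \<in> V \<Longrightarrow> c u v \<ge> 1"
begin

abbreviation "lap \<equiv> weighted_laplacian V c"

text \<open>Exchanging \<open>u\<close> and \<open>v\<close> in the double sum gives a second
  expression for the form; adding both completes the squares. The factor 2 reflects that each pair
  occurs in both orders.\<close>

lemma dirichlet_form: "2 * (\<Sum>u\<in>V. f u * lap f u) = (\<Sum>u\<in>V. \<Sum>v\<in>V. c u v * (f u - f v)\<^sup>2)"
proof -
  have 1: "(\<Sum>u\<in>V. f u * lap f u) = (\<Sum>u\<in>V. \<Sum>v\<in>V. c u v * (f u * (f u - f v)))"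
    by (simp add: weighted_laplacian_def sum_distrib_left mult_ac)
  also have "\<dots> = (\<Sum>u\<in>V. \<Sum>v\<in>V. c u v * (f v * (f v - f u)))"
    by (subst sum.swap) (auto simp: sym intro!: sum.cong)
  finally have "2 * (\<Sum>u\<in>V. f u * lap f u) = (\<Sum>u\<in>V. \<Sum>v\<in>V. c u v * (f u * (f u - f v)))
      + (\<Sum>u\<in>V. \<Sum>v\<in>V. c u v * (f v * (f v - f u)))"
    using 1 by simp
  also have "\<dots> = (\<Sum>u\<in>V. \<Sum>v\<in>V. c u v * (f u - f v)\<^sup>2)"
    by (simp flip: sum.distrib distrib_left) (simp add: power2_eq_square algebra_simps)
  finally show ?thesis .
qed

text \<open>The summands are antisymmetric in \<open>u\<close> and \<open>v\<close>, so the double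
  sum is its own negative.\<close>

lemma sum_lap: "(\<Sum>u\<in>V. lap f u) = 0"
proof -
  have "(\<Sum>u\<in>V. lap f u) = (\<Sum>u\<in>V. \<Sum>v\<in>V. c u v * (f v - f u))"
    unfolding weighted_laplacian_def by (subst sum.swap) (auto simp: sym intro!: sum.cong)
  also have "\<dots> = - (\<Sum>u\<in>V. lap f u)"
    by (simp add: weighted_laplacian_def algebra_simps flip: sum_negf)
  finally show ?thesis by simp
qed

lemma eigenfunction_sum_zero:
  assumes "\<And>u. u \<in> V \<Longrightarrow> lap f u = e * f u" and "e \<noteq> 0"
  shows "(\<Sum>u\<in>V. f u) = 0"
proof -
  have "e * (\<Sum>u\<in>V. f u) = (\<Sum>u\<in>V. lap f u)" using assms(1) by (simp add: sum_distrib_left)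
  then show ?thesis using sum_lap assms(2) by simp
qed

text \<open>The Dirichlet form of \<open>f\<close> vanishes and its terms are nonnegative, so each
  of them is 0; every pair has positive weight.\<close>

lemma lap_zero_imp_constant:
  assumes "\<And>u. u \<in> V \<Longrightarrow> lap f u = 0" and "u \<in> V" "v \<in> V"
  shows "f u = f v"
proof -
  have nonneg: "c x y * (f x - f y)\<^sup>2 \<ge> 0" if "x \<in> V" "y \<in> V" for x y
    using ge1[OF that] by simp
  have "(\<Sum>x\<in>V. \<Sum>y\<in>V. c x y * (f x - f y)\<^sup>2) = 0"
    using assms(1) by (simp flip: dirichlet_form)
  then have "(\<Sum>y\<in>V. c u y * (f u - f y)\<^sup>2) = 0"
    using fin assms(2) nonneg by (subst (asm) sum_nonneg_eq_0_iff) (auto intro!: sum_nonneg)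
  then have "c u v * (f u - f v)\<^sup>2 = 0"
    using fin assms(2,3) nonneg by (subst (asm) sum_nonneg_eq_0_iff) auto
  then show ?thesis using ge1[OF assms(2,3)] by auto
qed

text \<open>Since \<open>f\<close> sums to zero, the cross terms in the sum of all
  \<open>(f u - f v)\<^sup>2\<close> vanish and \<open>2 * card V * ?N\<close> remains. Weights of
  at least 1 bound this by the Dirichlet form, which is \<open>2 * e * ?N\<close>.\<close>

lemma nonzero_eigenvalue_ge_card:
  assumes ev: "\<And>u. u \<in> V \<Longrightarrow> lap f u = e * f u" and "e \<noteq> 0" and "x \<in> V" "f x \<noteq> 0"
  shows "e \<ge> card V"
proof -
  let ?N = "\<Sum>u\<in>V. (f u)\<^sup>2"
  have pos: "?N > 0" using fin assms(3,4) by (intro sum_pos2[of V x]) auto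
  have zero: "(\<Sum>u\<in>V. f u) = 0" using eigenfunction_sum_zero[OF ev assms(2)] .
  have "(\<Sum>u\<in>V. \<Sum>v\<in>V. (f u - f v)\<^sup>2) = (\<Sum>u\<in>V. (card V * (f u)\<^sup>2 + ?N) - 2 * f u * (\<Sum>v\<in>V. f v))"
    by (intro sum.cong refl)
      (simp add: power2_diff sum.distrib sum_subtractf sum_distrib_left sum_distrib_right mult_ac)
  also have "\<dots> = 2 * card V * ?N"
    unfolding zero by (simp add: sum.distrib sum_distrib_left[symmetric])
  finally have "2 * card V * ?N = (\<Sum>u\<in>V. \<Sum>v\<in>V. 1 * (f u - f v)\<^sup>2)" by simp
  also have "\<dots> \<le> (\<Sum>u\<in>V. \<Sum>v\<in>V. c u v * (f u - f v)\<^sup>2)"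
    by (intro sum_mono mult_right_mono ge1) auto
  also have "\<dots> = 2 * (\<Sum>u\<in>V. f u * lap f u)" by (simp add: dirichlet_form)
  also have "(\<Sum>u\<in>V. f u * lap f u) = e * ?N"
    using ev by (simp add: sum_distrib_left power2_eq_square mult_ac)
  finally show ?thesis using pos by simp
qed

text \<open>Within a side of the cut the differences of \<open>f\<close> vanish. Across it they are
  \<open>card A + card B\<close> in absolute value with weight 1, and their number is the size of
  the opposite side, which is the absolute value of \<open>f u\<close>.\<close>

lemma unit_cut_eigenfunction:
  fixes f :: "'a \<Rightarrow> real"
  assumes AB: "V = A \<union> B" "A \<inter> B = {}"
    and cut: "\<And>a b. a \<in> A \<Longrightarrow> b \<in> B \<Longrightarrow> c a b = 1"
    and u: "u \<in> V"
  defines "f \<equiv> \<lambda>v. if v \<in> A then real (card B) else - real (card A)"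
  shows "lap f u = card V * f u"
proof -
  have finAB: "finite A" "finite B" using fin AB(1) by auto
  have card: "card V = card A + card B" using AB finAB by (simp add: card_Un_disjoint)
  have split: "lap f u = (\<Sum>v\<in>A. c u v * (f u - f v)) + (\<Sum>v\<in>B. c u v * (f u - f v))"
    unfolding weighted_laplacian_def AB(1) using AB(2) finAB by (rule sum.union_disjoint[rotated 2])
  have cut': "c b a = 1" if "a \<in> A" "b \<in> B" for a b using cut[OF that] sym[of a b] that AB(1) by auto
  have fB: "f v = - real (card A)" if "v \<in> B" for v using that AB(2) by (auto simp: f_def)
  have fA: "f v = real (card B)" if "v \<in> A" for v using that by (auto simp: f_def)
  show ?thesis
  proof (cases "u \<in> A")
    case True
    then show ?thesis unfolding split card by (simp add: fA fB cut algebra_simps)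
  next
    case False
    then have "u \<in> B" using u AB(1) by auto
    then show ?thesis unfolding split card by (simp add: fA fB cut' algebra_simps)
  qed
qed

text \<open>Numerator and denominator of the Rayleigh quotient. The pair \<open>u\<close>,
  \<open>v\<close> has squared difference 4 and is counted once in each of the two weight sums,
  which leaves the surplus \<open>2 * c u v\<close>.\<close>

lemma lap_difference_form:
  fixes f :: "'a \<Rightarrow> real"
  assumes uv: "u \<in> V" "v \<in> V" "u \<noteq> v"
  defines "f \<equiv> \<lambda>w. if w = u then 1 else if w = v then - 1 else 0"
  shows "(\<Sum>w\<in>V. f w * lap f w) = (\<Sum>w\<in>V - {u}. c u w) + (\<Sum>w\<in>V - {v}. c v w) + 2 * c u v"
    and "(\<Sum>w\<in>V. f w * f w) = 2"
proof -
  have V: "V = insert u (insert v (V - {u, v}))" using uv by auto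
  have sum2: "(\<Sum>w\<in>V. g w) = g u + g v" if "\<And>w. w \<in> V - {u, v} \<Longrightarrow> g w = 0" for g :: "'a \<Rightarrow> real"
    by (subst V, use fin uv that in simp)
  have Vu: "V - {u} = insert v (V - {u, v})" and Vv: "V - {v} = insert u (V - {u, v})"
    using uv by auto
  have "lap f u = 2 * c u v + (\<Sum>w\<in>V - {u, v}. c u w)"
    unfolding weighted_laplacian_def by (subst V) (use fin uv in \<open>simp add: f_def\<close>)
  moreover have "lap f v = - 2 * c v u - (\<Sum>w\<in>V - {u, v}. c v w)"
    unfolding weighted_laplacian_def
    by (subst V) (use fin uv in \<open>simp add: f_def flip: sum_negf\<close>)
  moreover have "(\<Sum>w\<in>V. f w * lap f w) = lap f u - lap f v"
    using uv by (subst sum2) (auto simp: f_def)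
  ultimately show "(\<Sum>w\<in>V. f w * lap f w) = (\<Sum>w\<in>V - {u}. c u w) + (\<Sum>w\<in>V - {v}. c v w) + 2 * c u v"
    unfolding Vu Vv using fin uv sym[of v u] by simp
  show "(\<Sum>w\<in>V. f w * f w) = 2" using uv by (subst sum2) (auto simp: f_def)
qed

end

subsection \<open>Distances\<close>

lemma graph_dist_adjacent:
  assumes "u \<in> pverts G" and "u \<noteq> v" and "(u, v) \<in> parcs G"
  shows "graph_dist G u v = 1"
  unfolding graph_dist_def
proof (rule Least_equality)
  have "pre_digraph.apath (with_proj G) u [(u, v)] v"
    using assms by (simp add: pre_digraph.apath_def pre_digraph.awalk_def
      pre_digraph.cas.simps pre_digraph.awalk_verts.simps)
  then show "\<exists>p. pre_digraph.apath (with_proj G) u p v \<and> length p = 1" by fastforce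
next
  fix l assume "\<exists>p. pre_digraph.apath (with_proj G) u p v \<and> length p = l"
  then show "1 \<le> l" using assms(2)
    by (cases l) (auto simp: pre_digraph.apath_def pre_digraph.awalk_def pre_digraph.cas.simps)
qed

lemma graph_dist_common_neighbour:
  assumes "u \<in> pverts G" and "u \<noteq> v" "w \<noteq> u" "w \<noteq> v" and "(u, v) \<notin> parcs G"
    and "(u, w) \<in> parcs G" "(w, v) \<in> parcs G"
  shows "graph_dist G u v = 2"
  unfolding graph_dist_def
proof (rule Least_equality)
  have "pre_digraph.apath (with_proj G) u [(u, w), (w, v)] v"
    using assms by (simp add: pre_digraph.apath_def pre_digraph.awalk_def
      pre_digraph.cas.simps pre_digraph.awalk_verts.simps)
  then show "\<exists>p. pre_digraph.apath (with_proj G) u p v \<and> length p = 2" by fastforce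
next
  fix l assume "\<exists>p. pre_digraph.apath (with_proj G) u p v \<and> length p = l"
  then obtain p where p: "pre_digraph.awalk (with_proj G) u p v" "length p = l"
    by (auto simp: pre_digraph.apath_def)
  show "2 \<le> l"
  proof (rule ccontr)
    assume "\<not> 2 \<le> l"
    then consider "p = []" | e where "p = [e]" using p(2) by (cases p; cases "tl p") auto
    then show False using p(1) assms(2,5)
      by cases (auto simp: pre_digraph.awalk_def pre_digraph.cas.simps)
  qed
qed

text \<open>Take for \<open>A\<close> the component of a vertex \<open>u\<close> in the complement.
  A missing arc from \<open>A\<close> to the outside would be an edge of the complement and would
  extend the component.\<close>

lemma disconnected_complement_cut:
  assumes "\<not> Digraph_Component.connected (with_proj (graph_complement G))" and "pverts G \<noteq> {}"
  obtains A B where "pverts G = A \<union> B" "A \<inter> B = {}" "A \<noteq> {}" "B \<noteq> {}"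
    and "\<And>a b. a \<in> A \<Longrightarrow> b \<in> B \<Longrightarrow> (a, b) \<in> parcs G"
proof -
  let ?V = "pverts G" and ?S = "mk_symmetric (with_proj (graph_complement G))"
  have V: "pverts ?S = ?V" by (simp add: graph_complement_def)
  \<comment> \<open>Connectedness is strong connectivity of the symmetric closure \<open>?S\<close>,
    which includes having a vertex; as \<open>G\<close> has vertices, it must fail at some
    pair.\<close>
  obtain u v where uv: "u \<in> ?V" "v \<in> ?V" "\<not> u \<rightarrow>\<^sup>*\<^bsub>with_proj ?S\<^esub> v"
    using assms V unfolding connected_def strongly_connected_def by auto
  define A where "A = {w \<in> ?V. u \<rightarrow>\<^sup>*\<^bsub>with_proj ?S\<^esub> w}"
  have "(a, b) \<in> parcs G" if a: "a \<in> A" and b: "b \<in> ?V - A" for a b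
  proof (rule ccontr)
    assume "(a, b) \<notin> parcs G"
    then have "(a, b) \<in> parcs ?S"
      using a b by (auto simp: A_def parcs_mk_symmetric graph_complement_def)
    then have "u \<rightarrow>\<^sup>*\<^bsub>with_proj ?S\<^esub> b"
      using a b V unfolding A_def reachable_def by (auto intro: rtrancl_on_into_rtrancl_on)
    then show False using b by (simp add: A_def)
  qed
  moreover have "u \<in> A" using uv V by (auto simp: A_def reachable_def)
  moreover have "v \<in> ?V - A" using uv by (simp add: A_def)
  ultimately show ?thesis by (intro that[of A "?V - A"]) (auto simp: A_def)
qed

subsection \<open>The distance Laplacian as an operator on vertex functions\<close>

text \<open>Translates functions on the vertices, on which the Laplacian acts without any
  enumeration, into the vectors on which the matrix acts.\<close>

definition vertex_vec :: "'a list \<Rightarrow> ('a \<Rightarrow> real) \<Rightarrow> real vec" where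
  "vertex_vec vs f = vec (length vs) (\<lambda>i. f (vs ! i))"

lemma vertex_vec_carrier [simp]: "vertex_vec vs f \<in> carrier_vec (length vs)"
  by (simp add: vertex_vec_def)

lemma vertex_vec_surj:
  assumes "distinct vs" and "x \<in> carrier_vec (length vs)"
  obtains f where "x = vertex_vec vs f"
proof
  show "x = vertex_vec vs (\<lambda>v. x $ (THE i. i < length vs \<and> vs ! i = v))"
  proof (rule eq_vecI)
    fix i assume "i < dim_vec (vertex_vec vs (\<lambda>v. x $ (THE i. i < length vs \<and> vs ! i = v)))"
    then have i: "i < length vs" by (simp add: vertex_vec_def)
    then have "(THE j. j < length vs \<and> vs ! j = vs ! i) = i"
      using assms(1) by (intro the_equality) (auto simp: nth_eq_iff_index_eq)
    then show "x $ i = vertex_vec vs (\<lambda>v. x $ (THE i. i < length vs \<and> vs ! i = v)) $ i"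
      using i by (simp add: vertex_vec_def)
  qed (use assms(2) in \<open>simp add: vertex_vec_def\<close>)
qed

lemma vertex_vec_eq_iff: "vertex_vec vs f = vertex_vec vs g \<longleftrightarrow> (\<forall>v\<in>set vs. f v = g v)"
  by (auto simp: vertex_vec_def vec_eq_iff all_set_conv_all_nth)

lemma sum_nth_distinct:
  assumes "distinct vs"
  shows "(\<Sum>j<length vs. g (vs ! j)) = sum g (set vs)"
  by (rule sum.reindex_bij_betw) (rule bij_betw_nth[OF assms refl refl])

lemma scalar_prod_vertex_vec:
  assumes "distinct vs"
  shows "vertex_vec vs f \<bullet> vertex_vec vs g = (\<Sum>v\<in>set vs. f v * g v)"
  by (simp add: vertex_vec_def scalar_prod_def sum_nth_distinct[OF assms, symmetric] lessThan_atLeast0)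

lemma distance_laplacian_carrier [simp]:
  "distance_laplacian G vs \<in> carrier_mat (length vs) (length vs)"
  by (simp add: distance_laplacian_def distance_matrix_def mat_diag_def minus_carrier_mat)

lemma distance_laplacian_mult_vertex_vec:
  assumes vs: "distinct vs" "set vs = pverts G"
    and sym: "\<And>u v. u \<in> pverts G \<Longrightarrow> v \<in> pverts G \<Longrightarrow> graph_dist G u v = graph_dist G v u"
  shows "distance_laplacian G vs *\<^sub>v vertex_vec vs f
    = vertex_vec vs (weighted_laplacian (pverts G) (\<lambda>u v. real (graph_dist G u v)) f)"
    (is "?M *\<^sub>v _ = vertex_vec vs ?g")
proof (rule eq_vecI)
  fix i assume "i < dim_vec (vertex_vec vs ?g)"
  then have i: "i < length vs" by (simp add: vertex_vec_def)
  let ?u = "vs ! i" and ?d = "\<lambda>u v. real (graph_dist G u v)"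
  have u: "?u \<in> pverts G" unfolding vs(2)[symmetric] using i by (rule nth_mem)
  have "(?M *\<^sub>v vertex_vec vs f) $ i
      = (\<Sum>j<length vs. (if i = j then real (transmission G ?u) * f ?u else 0)
          - ?d ?u (vs ! j) * f (vs ! j))"
    using i by (auto simp: distance_laplacian_def distance_matrix_def mat_diag_def vertex_vec_def
        scalar_prod_def lessThan_atLeast0 algebra_simps intro!: sum.cong)
  also have "\<dots> = real (transmission G ?u) * f ?u - (\<Sum>v\<in>pverts G. ?d ?u v * f v)"
    using i by (simp add: sum_subtractf vs(2) sum_nth_distinct[OF vs(1), of "\<lambda>v. ?d ?u v * f v"])
  \<comment> \<open>The transmission sums the distances towards its vertex, whereas a matrix row
    contains those from it; symmetry identifies the two.\<close>
  also have "real (transmission G ?u) = (\<Sum>v\<in>pverts G. ?d ?u v)"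
    unfolding transmission_def of_nat_sum using sym u by (intro sum.cong) auto
  also have "\<dots> * f ?u - (\<Sum>v\<in>pverts G. ?d ?u v * f v) = vertex_vec vs ?g $ i"
    using i by (simp add: vertex_vec_def weighted_laplacian_def sum_distrib_right
        right_diff_distrib sum_subtractf)
  finally show "(?M *\<^sub>v vertex_vec vs f) $ i = vertex_vec vs ?g $ i" .
qed (simp add: vertex_vec_def distance_laplacian_def distance_matrix_def)

lemma distance_laplacian_symmetric:
  assumes "set vs = pverts G"
    and "\<And>u v. u \<in> pverts G \<Longrightarrow> v \<in> pverts G \<Longrightarrow> graph_dist G u v = graph_dist G v u"
  shows "(distance_laplacian G vs)\<^sup>T = distance_laplacian G vs"
  using assms nth_mem[of _ vs]
  by (intro eq_matI) (auto simp: distance_laplacian_def distance_matrix_def mat_diag_def)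

subsection \<open>Graphs with disconnected complement\<close>

text \<open>The disconnected complement enters as a cut without complement edges: \<open>G\<close>
  is the join of its subgraphs on \<open>A\<close> and \<open>B\<close>.\<close>

locale graph_with_cut = pair_graph G for G :: "'a pair_pre_digraph" +
  fixes vs :: "'a list" and A B :: "'a set"
  assumes distinct_vs: "distinct vs" and set_vs: "set vs = pverts G"
    and cut: "pverts G = A \<union> B" "A \<inter> B = {}" "A \<noteq> {}" "B \<noteq> {}"
    and complete: "\<And>a b. a \<in> A \<Longrightarrow> b \<in> B \<Longrightarrow> (a, b) \<in> parcs G"
begin

abbreviation "V \<equiv> pverts G"
abbreviation "M \<equiv> distance_laplacian G vs"

text \<open>The diagonal value is 1 instead of the distance 0, so that the lower bound of
  \<open>symmetric_weights\<close> holds for all pairs; the operator \<open>lap\<close> is the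
  same.\<close>

definition weight :: "'a \<Rightarrow> 'a \<Rightarrow> real" where
  "weight u v = (if u = v \<or> (u, v) \<in> parcs G then 1 else 2)"

lemma arc_sym: "(u, v) \<in> parcs G \<longleftrightarrow> (v, u) \<in> parcs G"
  using graph_symmetric by blast

lemma complete': "b \<in> B \<Longrightarrow> a \<in> A \<Longrightarrow> (b, a) \<in> parcs G"
  using complete arc_sym by blast

text \<open>Distinct non-adjacent vertices lie on the same side of the cut, and any vertex of the
  other side is a common neighbour.\<close>

lemma weight_eq_dist:
  assumes "u \<in> V" "v \<in> V" "u \<noteq> v"
  shows "real (graph_dist G u v) = weight u v"
proof (cases "(u, v) \<in> parcs G")
  case True
  then show ?thesis using graph_dist_adjacent[of u G v] assms by (simp add: weight_def)
next
  case False
  have "\<exists>w. (u, w) \<in> parcs G \<and> (w, v) \<in> parcs G"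
    using assms False cut complete complete' by (metis UnE all_not_in_conv)
  then obtain w where w: "(u, w) \<in> parcs G" "(w, v) \<in> parcs G" by blast
  then have "w \<noteq> u" "w \<noteq> v" using pair_no_loops by force+
  then have "graph_dist G u v = 2" using graph_dist_common_neighbour[of u G v w] assms False w by simp
  then show ?thesis using False assms(3) by (simp add: weight_def)
qed

lemma graph_dist_sym: "u \<in> V \<Longrightarrow> v \<in> V \<Longrightarrow> graph_dist G u v = graph_dist G v u"
proof (cases "u = v")
  case False
  assume "u \<in> V" "v \<in> V"
  then have "real (graph_dist G u v) = real (graph_dist G v u)"
    using weight_eq_dist[of u v] weight_eq_dist[of v u] False arc_sym[of u v] by (simp add: weight_def)
  then show ?thesis by simp
qed simp

sublocale symmetric_weights V weight
  by unfold_locales (auto simp: weight_def arc_sym pair_finite_verts)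

lemma length_vs: "length vs = card V"
  using distinct_card[OF distinct_vs] set_vs by simp

lemma M_symmetric: "M\<^sup>T = M"
  using distance_laplacian_symmetric[OF set_vs graph_dist_sym] by simp

lemma M_mult: "M *\<^sub>v vertex_vec vs f = vertex_vec vs (lap f)"
proof -
  have "M *\<^sub>v vertex_vec vs f
      = vertex_vec vs (weighted_laplacian V (\<lambda>u v. real (graph_dist G u v)) f)"
    by (rule distance_laplacian_mult_vertex_vec[OF distinct_vs set_vs]) (rule graph_dist_sym)
  also have "\<dots> = vertex_vec vs (lap f)"
    unfolding vertex_vec_eq_iff set_vs
    by (intro ballI weighted_laplacian_cong) (auto simp: weight_eq_dist)
  finally show ?thesis .
qed

lemma eigenvector_vertex_vec_iff:
  "eigenvector M (vertex_vec vs f) e \<longleftrightarrow> (\<exists>u\<in>V. f u \<noteq> 0) \<and> (\<forall>u\<in>V. lap f u = e * f u)"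
proof -
  have "e \<cdot>\<^sub>v vertex_vec vs f = vertex_vec vs (\<lambda>u. e * f u)" "0\<^sub>v (length vs) = vertex_vec vs (\<lambda>_. 0)"
    by (auto simp: vertex_vec_def intro!: eq_vecI)
  moreover have "dim_row M = length vs" using distance_laplacian_carrier by blast
  ultimately show ?thesis
    unfolding eigenvector_def M_mult by (simp add: vertex_vec_eq_iff set_vs)
qed

lemma eigenvectorE:
  assumes "eigenvector M x e"
  obtains f where "x = vertex_vec vs f" "\<exists>u\<in>V. f u \<noteq> 0" "\<And>u. u \<in> V \<Longrightarrow> lap f u = e * f u"
proof -
  have "dim_row M = length vs" using distance_laplacian_carrier by blast
  then have "x \<in> carrier_vec (length vs)" using assms by (simp add: eigenvector_def)
  then obtain f where "x = vertex_vec vs f" using vertex_vec_surj[OF distinct_vs] by blast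
  then show ?thesis using that assms eigenvector_vertex_vec_iff by blast
qed

lemma finite_cut: "finite A" "finite B" "finite V"
  using pair_finite_verts cut(1) by auto

lemma card_V_ge_2: "card V \<ge> 2"
proof -
  have "card V = card A + card B" using cut finite_cut by (simp add: card_Un_disjoint)
  moreover have "card A > 0" "card B > 0" using cut finite_cut by (auto simp: card_gt_0_iff)
  ultimately show ?thesis by linarith
qed

section \<open>The second smallest eigenvalue\<close>

text \<open>The kernel consists of the constant functions, so 0 is simple; no other eigenvalue is
  below \<open>card V\<close>, and the cut function attains \<open>card V\<close> because all
  weights across the cut are 1.\<close>

lemma dl_eigenvalue_second_smallest: "dl_eigenvalue G vs (length vs - 1) = card V"
proof -
  let ?R = "proots (char_poly M)"
  have ev: "e \<in># ?R \<longleftrightarrow> eigenvalue M e" for e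
    using set_real_eigenvalues[of M "length vs"] by (auto simp: real_eigenvalues_def)
  have zero: "eigenvalue M 0"
    unfolding eigenvalue_def
    using eigenvector_vertex_vec_iff[of "\<lambda>_. 1" 0] cut by (auto simp: weighted_laplacian_def)
  have "count ?R 0 = 1"
  proof (rule real_eigenvalue_simple[OF distance_laplacian_carrier M_symmetric zero])
    fix x y assume x: "eigenvector M x 0" and y: "eigenvector M y 0"
    from x obtain f u where f: "x = vertex_vec vs f" "u \<in> V" "f u \<noteq> 0" "\<And>u. u \<in> V \<Longrightarrow> lap f u = 0"
      by (auto elim!: eigenvectorE)
    from y obtain g v where g: "y = vertex_vec vs g" "v \<in> V" "g v \<noteq> 0" "\<And>u. u \<in> V \<Longrightarrow> lap g u = 0"
      by (auto elim!: eigenvectorE)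
    \<comment> \<open>Eigenfunctions for 0 are nonzero constants, and two such are never
      orthogonal.\<close>
    have "f w = f u" "g w = g v" if "w \<in> V" for w
      using lap_zero_imp_constant[OF f(4) that f(2)] lap_zero_imp_constant[OF g(4) that g(2)] by auto
    then have "x \<bullet> y = card V * (f u * g v)"
      by (simp add: f(1) g(1) scalar_prod_vertex_vec[OF distinct_vs] set_vs)
    then show "x \<bullet> y \<noteq> 0" using f(3) g(3) card_V_ge_2 by auto
  qed
  moreover have "eigenvalue M (card V)"
  proof -
    let ?f = "\<lambda>v. if v \<in> A then real (card B) else - real (card A)"
    have "lap ?f u = card V * ?f u" if "u \<in> V" for u
      using unit_cut_eigenfunction[OF cut(1,2) _ that] complete by (simp add: weight_def)
    moreover have "\<exists>u\<in>V. ?f u \<noteq> 0"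
      using cut finite_cut by (metis UnCI all_not_in_conv card_0_eq of_nat_eq_0_iff)
    ultimately show ?thesis
      unfolding eigenvalue_def using eigenvector_vertex_vec_iff by blast
  qed
  moreover have "e = 0 \<or> real (card V) \<le> e" if "eigenvalue M e" for e
    using that nonzero_eigenvalue_ge_card unfolding eigenvalue_def by (metis eigenvectorE)
  ultimately have "rev (sorted_list_of_multiset ?R) ! (size ?R - 2) = card V"
    using card_V_ge_2 by (intro second_smallest_of_sorted[of _ 0]) (auto simp: ev)
  moreover have "size ?R = length vs"
    using length_real_eigenvalues[OF distance_laplacian_carrier M_symmetric]
    unfolding real_eigenvalues_def by (metis length_rev mset_sorted_list_of_multiset size_mset)
  ultimately show ?thesis
    by (simp add: dl_eigenvalue_def real_eigenvalues_def numeral_2_eq_2)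
qed

lemma dl_spread_eq: "dl_spread G vs = real_eigenvalues M ! 0 - card V"
  unfolding dl_spread_def dl_eigenvalue_second_smallest by (simp add: dl_eigenvalue_def)

lemma largest_eigenfunction:
  obtains f where "\<exists>u\<in>V. f u \<noteq> 0" "\<And>u. u \<in> V \<Longrightarrow> lap f u = real_eigenvalues M ! 0 * f u"
proof -
  have "length (real_eigenvalues M) = length vs"
    using length_real_eigenvalues[OF distance_laplacian_carrier M_symmetric] .
  then have "real_eigenvalues M ! 0 \<in> set (real_eigenvalues M)"
    using card_V_ge_2 length_vs by (intro nth_mem) simp
  then have "eigenvalue M (real_eigenvalues M ! 0)"
    using set_real_eigenvalues[of M "length vs"] by simp
  then show ?thesis unfolding eigenvalue_def using that by (metis eigenvectorE)
qed

section \<open>Lower bounds from pairs of non-adjacent vertices\<close>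

text \<open>The neighbourhood of \<open>u\<close> in the complement; its size is the complement
  degree of \<open>u\<close>.\<close>

definition non_neighbours :: "'a \<Rightarrow> 'a set" where
  "non_neighbours u = {w \<in> V. w \<noteq> u \<and> (u, w) \<notin> parcs G}"

lemma sum_weight:
  assumes "u \<in> V"
  shows "(\<Sum>w\<in>V - {u}. weight u w) = real (card V) - 1 + card (non_neighbours u)"
proof -
  have "(\<Sum>w\<in>V - {u}. weight u w) = (\<Sum>w\<in>V - {u}. 1 + (if w \<in> non_neighbours u then 1 else 0))"
    by (intro sum.cong) (auto simp: weight_def non_neighbours_def)
  also have "\<dots> = card (V - {u}) + card ((V - {u}) \<inter> non_neighbours u)"
    using finite_cut by (simp add: sum.distrib flip: sum.inter_restrict)
  also have "(V - {u}) \<inter> non_neighbours u = non_neighbours u"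
    by (auto simp: non_neighbours_def)
  finally show ?thesis using assms finite_cut card_V_ge_2 by (simp add: of_nat_diff)
qed

text \<open>For the difference of the two indicators, the denominator of the Rayleigh quotient is 2
  and the numerator is \<open>2 * (card V - 1)\<close> plus both complement degrees plus 4.
  Subtracting \<open>2 * card V\<close> leaves the surplus 2.\<close>

lemma dl_spread_ge_non_neighbours:
  assumes uv: "u \<in> V" "v \<in> V" "u \<noteq> v" and "(u, v) \<notin> parcs G"
  shows "2 * dl_spread G vs \<ge> card (non_neighbours u) + card (non_neighbours v) + 2"
proof -
  let ?f = "\<lambda>w. if w = u then 1 else if w = v then - 1 else 0"
  let ?x = "vertex_vec vs ?f"
  have "?x \<bullet> (M *\<^sub>v ?x) \<le> real_eigenvalues M ! 0 * (?x \<bullet> ?x)"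
    by (rule rayleigh_le_largest_real_eigenvalue[OF distance_laplacian_carrier M_symmetric]) simp
  moreover have "weight u v = 2" using assms(3,4) by (simp add: weight_def)
  ultimately show ?thesis
    using lap_difference_form[OF uv]
    by (simp add: M_mult scalar_prod_vertex_vec[OF distinct_vs] set_vs sum_weight uv dl_spread_eq)
qed

text \<open>Each vertex of \<open>C\<close> has the other \<open>card C - 1\<close> vertices of
  \<open>C\<close> as non-neighbours; apply the bound for pairs to any two of them.\<close>

lemma dl_spread_ge_class:
  assumes "independent_class G C" and "card C \<ge> 2"
  shows "dl_spread G vs \<ge> card C"
proof -
  have finC: "finite C" using assms(2) by (intro card_ge_0_finite) simp
  have C: "C \<subseteq> V" "\<And>u v. u \<in> C \<Longrightarrow> v \<in> C \<Longrightarrow> (u, v) \<notin> parcs G"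
    using assms(1) by (auto simp: independent_class_def)
  have deg: "card C - 1 \<le> card (non_neighbours u)" if "u \<in> C" for u
  proof -
    have "C - {u} \<subseteq> non_neighbours u" using C that by (auto simp: non_neighbours_def)
    then have "card (C - {u}) \<le> card (non_neighbours u)"
      using finite_cut by (intro card_mono) (auto simp: non_neighbours_def)
    then show ?thesis using that finC by simp
  qed
  have "\<not> card C \<le> Suc 0" using assms(2) by simp
  then obtain u v where uv: "u \<in> C" "v \<in> C" "u \<noteq> v"
    unfolding card_le_Suc0_iff_eq[OF finC] by blast
  then have "2 * dl_spread G vs \<ge> card (non_neighbours u) + card (non_neighbours v) + 2"
    using C by (intro dl_spread_ge_non_neighbours) auto
  moreover have "card C + card C \<le> card (non_neighbours u) + card (non_neighbours v) + 2"
    using deg[OF uv(1)] deg[OF uv(2)] by linarith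
  ultimately show ?thesis by linarith
qed

text \<open>The outside vertex \<open>w\<close> is an additional non-neighbour of \<open>u\<close>,
  so pairing \<open>u\<close> with any other vertex of \<open>C\<close> improves the bound by one
  half.\<close>

lemma dl_spread_gt_incomplete_class:
  assumes C: "independent_class G C" "card C \<ge> 2" and u: "u \<in> C" and w: "w \<in> V - C" "(u, w) \<notin> parcs G"
  shows "dl_spread G vs > card C"
proof -
  have finC: "finite C" using assms(2) by (intro card_ge_0_finite) simp
  have C': "C \<subseteq> V" "\<And>u v. u \<in> C \<Longrightarrow> v \<in> C \<Longrightarrow> (u, v) \<notin> parcs G"
    using assms(1) by (auto simp: independent_class_def)
  have "\<not> card C \<le> Suc 0" using assms(2) by simp
  then obtain v where v: "v \<in> C" "v \<noteq> u"
    unfolding card_le_Suc0_iff_eq[OF finC] by blast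
  have "insert w (C - {u}) \<subseteq> non_neighbours u" using C' u w by (auto simp: non_neighbours_def)
  then have "card (insert w (C - {u})) \<le> card (non_neighbours u)"
    using finite_cut by (intro card_mono) (auto simp: non_neighbours_def)
  then have 1: "card C \<le> card (non_neighbours u)" using u w finC assms(2) by simp
  have "C - {v} \<subseteq> non_neighbours v" using C' v by (auto simp: non_neighbours_def)
  then have "card (C - {v}) \<le> card (non_neighbours v)"
    using finite_cut by (intro card_mono) (auto simp: non_neighbours_def)
  then have 2: "card C - 1 \<le> card (non_neighbours v)" using v finC by simp
  have "2 * dl_spread G vs \<ge> card (non_neighbours u) + card (non_neighbours v) + 2"
    using C' u v by (intro dl_spread_ge_non_neighbours) auto
  moreover have "card C + card C + 1 \<le> card (non_neighbours u) + card (non_neighbours v) + 2"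
    using 1 2 by linarith
  ultimately show ?thesis by linarith
qed

section \<open>The spread of balanced complete multipartite graphs\<close>

text \<open>Consider an eigenfunction for the largest eigenvalue \<open>e\<close>, supposed to
  exceed \<open>card V + m\<close>. On a class, the eigenvalue equation involves only the value at
  the vertex and the sum over the class; that sum must be 0, and then so is the function on the
  class.\<close>

lemma dl_spread_le_complete_equal_classes:
  assumes P: "complete_k_partition k G P" and eq: "\<And>C. C \<in> P \<Longrightarrow> card C = m"
  shows "dl_spread G vs \<le> m"
proof (rule ccontr)
  assume "\<not> dl_spread G vs \<le> m"
  define e where "e = real_eigenvalues M ! 0"
  have e: "e > card V + m" using \<open>\<not> _\<close> by (simp add: dl_spread_eq e_def)
  obtain f x where x: "x \<in> V" "f x \<noteq> 0" and f: "\<And>u. u \<in> V \<Longrightarrow> lap f u = e * f u"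
    unfolding e_def using largest_eigenfunction by metis
  have sum0: "(\<Sum>v\<in>V. f v) = 0" using eigenfunction_sum_zero[OF f] e by simp
  have part: "partition_on V P" and indep: "\<And>C. C \<in> P \<Longrightarrow> independent_class G C"
    and compl: "\<And>C D u v. C \<in> P \<Longrightarrow> D \<in> P \<Longrightarrow> C \<noteq> D \<Longrightarrow> u \<in> C \<Longrightarrow> v \<in> D \<Longrightarrow> (u, v) \<in> parcs G"
    using P unfolding complete_k_partition_def k_partition_def by auto
  obtain C where C: "C \<in> P" "x \<in> C" using part x(1) by (auto simp: partition_on_def)
  have CV: "C \<subseteq> V" using part C by (auto simp: partition_on_def)
  have weight_C: "weight u v = 1 + (if v \<in> C then 1 else 0)" if uv: "u \<in> C" "v \<in> V" "u \<noteq> v" for u v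
  proof (cases "v \<in> C")
    case True
    then show ?thesis using indep[OF C(1)] uv by (auto simp: independent_class_def weight_def)
  next
    case False
    obtain D where "D \<in> P" "v \<in> D" using part uv(2) by (auto simp: partition_on_def)
    then have "(u, v) \<in> parcs G" using compl[of C D u v] C(1) False uv(1) by auto
    then show ?thesis using False by (simp add: weight_def)
  qed
  \<comment> \<open>The complete graph contributes \<open>card V * f u\<close>, as \<open>f\<close>
    sums to zero; the complement edges at \<open>u\<close> stay inside \<open>C\<close> and
    contribute \<open>m * f u\<close> minus the class sum.\<close>
  have lap_C: "lap f u = (card V + m) * f u - (\<Sum>v\<in>C. f v)" if u: "u \<in> C" for u
  proof -
    have "lap f u = (\<Sum>v\<in>V. (f u - f v) + (if v \<in> C then f u - f v else 0))"
      unfolding weighted_laplacian_def using weight_C[OF u] by (intro sum.cong) force+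
    also have "\<dots> = (\<Sum>v\<in>V. f u - f v) + (\<Sum>v\<in>V \<inter> C. f u - f v)"
      using finite_cut by (simp add: sum.distrib sum.inter_restrict)
    also have "V \<inter> C = C" using CV by auto
    finally show ?thesis
      using eq[OF C(1)] by (simp add: sum_subtractf sum0 algebra_simps)
  qed
  have *: "(e - (card V + m)) * f u = - (\<Sum>v\<in>C. f v)" if "u \<in> C" for u
    using lap_C[OF that] f[of u] that CV by (auto simp: algebra_simps)
  \<comment> \<open>Summed over the \<open>m\<close> vertices of \<open>C\<close>, the right side
    becomes \<open>- m\<close> times the class sum, so the coefficient \<open>e - card V\<close> of
    that sum remains.\<close>
  have "(e - (card V + m)) * (\<Sum>u\<in>C. f u) = (\<Sum>u\<in>C. - (\<Sum>v\<in>C. f v))"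
    unfolding sum_distrib_left by (intro sum.cong refl *)
  then have "(e - card V) * (\<Sum>u\<in>C. f u) = 0"
    using eq[OF C(1)] by (simp add: algebra_simps)
  then have "(\<Sum>u\<in>C. f u) = 0" using e by simp
  then show False using *[OF C(2)] x(2) e by simp
qed

end

subsection \<open>The spread of k-partite graphs\<close>

theorem theorem4p6:
  fixes G :: "'a pair_pre_digraph" and vs :: "'a list" and n k :: nat
  assumes "pair_graph G"
    and "Digraph_Component.connected (with_proj G)"
    and "distinct vs" and "set vs = pverts G"
    and "n = card (pverts G)"
    and "2 \<le> k" and "k \<le> n - 1"
    and "k_partite k G"
    and "\<not> Digraph_Component.connected (with_proj (graph_complement G))"
  shows "dl_spread G vs \<ge> of_int \<lfloor>real n / real k\<rfloor> \<and>
    (dl_spread G vs = of_int \<lfloor>real n / real k\<rfloor> \<longleftrightarrow>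
      n mod k = 0 \<and>
      (\<exists>P. complete_k_partition k G P \<and> (\<forall>A\<in>P. \<forall>B\<in>P. card A = card B)))"
proof -
  let ?V = "pverts G"
  define q where "q = n div k"
  have floor: "of_int \<lfloor>real n / real k\<rfloor> = real q"
    by (simp add: q_def floor_divide_of_nat_eq)
  have nk: "n > k" "k > 0" using assms(6,7) by auto
  then have q1: "q \<ge> 1" by (simp add: q_def div_greater_zero_iff Suc_leI)
  have "?V \<noteq> {}" using nk assms(5) by auto
  then obtain A B where cut: "?V = A \<union> B" "A \<inter> B = {}" "A \<noteq> {}" "B \<noteq> {}"
    and complete: "\<And>a b. a \<in> A \<Longrightarrow> b \<in> B \<Longrightarrow> (a, b) \<in> parcs G"
    using disconnected_complement_cut[OF assms(9)] by metis
  interpret pair_graph G by fact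
  interpret graph_with_cut G vs A B
    using assms(3,4) cut complete by unfold_locales auto
  let ?S = "dl_spread G vs"
  have card_sum: "n = (\<Sum>C\<in>P. card C)" and finP: "finite P" if "k_partition k G P" for P
  proof -
    have "partition_on ?V P" using that by (simp add: k_partition_def)
    then have P: "\<Union>P = ?V" "disjoint P" by (auto simp: partition_on_def)
    show "finite P" using P(1) finite_cut(3) by (metis finite_UnionD)
    show "n = (\<Sum>C\<in>P. card C)"
      unfolding assms(5) P(1)[symmetric] using P finite_cut(3)
      by (intro card_Union_disjoint) (auto intro: finite_subset)
  qed
  \<comment> \<open>The 1 in the maximum covers singleton classes, which contain no pair of distinct
    non-adjacent vertices.\<close>
  have class_le: "real (card C) \<le> max 1 ?S" if "k_partition k G P" "C \<in> P" for C P
  proof (cases "card C \<ge> 2")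
    case True
    then show ?thesis using dl_spread_ge_class[of C] that by (fastforce simp: k_partition_def)
  qed auto
  obtain P where P: "k_partition k G P" using assms(8) by (auto simp: k_partite_def)
  have cardP: "card P = k" using P by (simp add: k_partition_def)
  have lower: "?S \<ge> real q"
  proof (rule ccontr)
    assume "\<not> ?S \<ge> real q"
    \<comment> \<open>As \<open>n > k\<close>, some class has two vertices; hence the maximum in
      \<open>class_le\<close> is the spread itself.\<close>
    have ge: "?S \<ge> 2"
    proof -
      have "\<exists>C\<in>P. card C \<ge> 2"
      proof (rule ccontr)
        assume "\<not> ?thesis"
        then have "(\<Sum>C\<in>P. card C) \<le> (\<Sum>C\<in>P. 1)" by (intro sum_mono) auto
        then show False using card_sum[OF P] cardP nk by simp
      qed
      then show ?thesis
        using dl_spread_ge_class P by (fastforce simp: k_partition_def)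
    qed
    \<comment> \<open>If the spread were below \<open>q\<close>, then \<open>k\<close> classes
      bounded by it could not contain \<open>k * q\<close> vertices.\<close>
    have "real n = (\<Sum>C\<in>P. real (card C))" using card_sum[OF P] by simp
    also have "\<dots> \<le> (\<Sum>C\<in>P. ?S)" using class_le[OF P] ge by (intro sum_mono) force
    also have "\<dots> < k * real q" using \<open>\<not> ?S \<ge> real q\<close> nk cardP by simp
    also have "\<dots> = real (k * q)" by simp
    also have "\<dots> \<le> real n" unfolding q_def of_nat_le_iff by simp
    finally show False by simp
  qed
  have fwd: "n mod k = 0 \<and> (\<exists>P. complete_k_partition k G P \<and> (\<forall>A\<in>P. \<forall>B\<in>P. card A = card B))"
    if eq: "?S = real q"
  proof -
    have le: "card C \<le> q" if "C \<in> P" for C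
      using class_le[OF P that] eq q1 by simp
    \<comment> \<open>There are \<open>k\<close> classes of size at most \<open>q\<close>, but at
      least \<open>k * q\<close> vertices: equality holds throughout.\<close>
    have "n \<le> k * q" using card_sum[OF P] sum_bounded_above[of P card q] le cardP by simp
    moreover have "k * q \<le> n" by (simp add: q_def)
    ultimately have nkq: "n = k * q" by simp
    have sizes: "card C = q" if "C \<in> P" for C
    proof (rule ccontr)
      assume "card C \<noteq> q"
      then have "card C < q" using le[OF that] by simp
      then have "(\<Sum>C\<in>P. card C) < (\<Sum>C\<in>P. q)"
        using le that finP[OF P] by (intro sum_strict_mono_ex1) auto
      then show False using card_sum[OF P] cardP nkq by simp
    qed
    \<comment> \<open>For \<open>q = 1\<close> one would have \<open>n = k\<close>. Size at least 2
      is needed for the strict bound on incomplete classes.\<close>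
    have q2: "q \<ge> 2" using nkq nk q1 by (cases "q = 1") auto
    \<comment> \<open>A missing arc between two classes would push the spread above the class size
      \<open>q\<close>.\<close>
    have "(u, v) \<in> parcs G" if "C \<in> P" "D \<in> P" "C \<noteq> D" "u \<in> C" "v \<in> D" for C D u v
    proof (rule ccontr)
      assume na: "(u, v) \<notin> parcs G"
      have part: "partition_on ?V P" using P by (simp add: k_partition_def)
      have "v \<in> ?V - C"
        using part that partition_onD1[OF part] disjointD[OF partition_onD2[OF part], of C D] by auto
      then have "?S > card C"
        using dl_spread_gt_incomplete_class[of C u v] P that na sizes q2 by (simp add: k_partition_def)
      then show False using sizes[OF that(1)] eq by simp
    qed
    then have "complete_k_partition k G P" using P by (simp add: complete_k_partition_def)
    then show ?thesis using nkq sizes by auto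
  qed
  have bwd: "?S = real q"
    if Q: "complete_k_partition k G Q" "\<forall>A\<in>Q. \<forall>B\<in>Q. card A = card B" for Q
  proof -
    have kQ: "k_partition k G Q" using Q(1) by (simp add: complete_k_partition_def)
    then have cardQ: "card Q = k" by (simp add: k_partition_def)
    have "card C = q" if C: "C \<in> Q" for C
    proof -
      have "(\<Sum>D\<in>Q. card D) = (\<Sum>D\<in>Q. card C)"
        using Q(2) C by (intro sum.cong refl) blast
      then have "n = (\<Sum>D\<in>Q. card C)" using card_sum[OF kQ] by (simp only:)
      then show ?thesis using cardQ nk by (simp add: q_def)
    qed
    then have "?S \<le> q" using dl_spread_le_complete_equal_classes[OF Q(1)] by blast
    then show ?thesis using lower by simp
  qed
  show ?thesis
    unfolding floor
  proof (intro conjI iffI)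
    assume "n mod k = 0 \<and> (\<exists>P. complete_k_partition k G P \<and> (\<forall>A\<in>P. \<forall>B\<in>P. card A = card B))"
    then show "?S = real q" using bwd by blast
  qed (use lower fwd in simp_all)
qed

end
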